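(* Let $\mathcal{K}^{\langle\infty\rangle}$ be a planar unbounded simple nested fractal whose number $k\ge3$ of essential fixed points is even. Then $\mathcal{K}^{\langle\infty\rangle}$ has the good labelling property if and only if the $0$-complexes contained in $\mathcal{K}^{\langle 1\rangle}$ can be split into two disjoint classes such that each complex from one class intersects only complexes from the other class.
   Context: Setting: $L>1$, $N\ge2$, $\nu_1=0,\dots,\nu_N\in\mathbb{R}^2$, $\Psi_i(x)=x/L+\nu_i$, and $\mathcal{K}^{\langle 0\rangle}=\bigcup_i\Psi_i(\mathcal{K}^{\langle 0\rangle})$ is a planar simple nested fractal (essential fixed points $V_0^{\langle0\rangle}$: fixed points $x$ for which there are another fixed point $y$ and $\Psi_i\ne\Psi_j$ with $\Psi_i(x)=\Psi_j(y)$; open set condition, nesting, symmetry with respect to perpendicular bisectors of pairs of essential fixed points, connectivity); $k=\#V_0^{\langle0\rangle}$, and $V_0^{\langle0\rangle}$ spans a regular $k$-gon. $\mathcal{K}^{\langle M\rangle}=L^M\mathcal{K}^{\langle 0\rangle}$, $\mathcal{K}^{\langle\infty\rangle}=\bigcup_{M\ge0}\mathcal{K}^{\langle M\rangle}$. An $M$-complex is $\Delta_M=\mathcal{K}^{\langle M\rangle}+\nu_{\Delta_M}$ with $\nu_{\Delta_M}=\sum_{j=M+1}^{J}L^j\nu_{i_j}$ ($J\ge M+1$), vertex set $V(\Delta_M)=L^MV_0^{\langle0\rangle}+\nu_{\Delta_M}$; $V_M^{\langle M\rangle}=L^MV_0^{\langle0\rangle}$ and $V_M^{\langle\infty\rangle}$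 is the union of all $V(\Delta_M)$. With $\mathcal{A}$ an alphabet of $k$ symbols and $\mathcal{R}_M$ the $k$ rotations about the barycenter of $\mathcal{K}^{\langle M\rangle}$ preserving $V_M^{\langle M\rangle}$, a good labelling function of order $M$ is $\ell_M:V_M^{\langle\infty\rangle}\to\mathcal{A}$, bijective on $V_M^{\langle M\rangle}$, such that for each $M$-complex $\Delta_M=\mathcal{K}^{\langle M\rangle}+\nu_{\Delta_M}$ there is $R_{\Delta_M}\in\mathcal{R}_M$ with $\ell_M(v)=\ell_M(R_{\Delta_M}(v-\nu_{\Delta_M}))$, $v\in V(\Delta_M)$. The good labelling property means that a good labelling function of some order $M\in\mathbb{Z}$ exists. *)

theory Defs
  imports "HOL-Analysis.Analysis"
begin

text \<open>The plane is modelled by the type complex. The IFS is given by L, N and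
  the translation vectors nu 1, ..., nu N (indices 1..N), Psi_i(x) = x/L + nu_i.\<close>

definition Psi :: "real \<Rightarrow> (nat \<Rightarrow> complex) \<Rightarrow> nat \<Rightarrow> complex \<Rightarrow> complex" where
  "Psi L \<nu> i x = x / of_real L + \<nu> i"

fun Psiw :: "real \<Rightarrow> (nat \<Rightarrow> complex) \<Rightarrow> nat list \<Rightarrow> complex \<Rightarrow> complex" where
  "Psiw L \<nu> [] x = x"
| "Psiw L \<nu> (i # w) x = Psi L \<nu> i (Psiw L \<nu> w x)"

definition words :: "nat \<Rightarrow> nat \<Rightarrow> nat list set" where
  "words N n = {w. length w = n \<and> set w \<subseteq> {1..N}}"

definition V0 :: "real \<Rightarrow> nat \<Rightarrow> (nat \<Rightarrow> complex) \<Rightarrow> complex set" where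
  "V0 L N \<nu> = {x. (\<exists>i\<in>{1..N}. Psi L \<nu> i x = x) \<and>
      (\<exists>y. (\<exists>j\<in>{1..N}. Psi L \<nu> j y = y) \<and>
        (\<exists>i'\<in>{1..N}. \<exists>j'\<in>{1..N}. Psi L \<nu> i' \<noteq> Psi L \<nu> j' \<and> Psi L \<nu> i' x = Psi L \<nu> j' y))}"

definition Vn :: "real \<Rightarrow> nat \<Rightarrow> (nat \<Rightarrow> complex) \<Rightarrow> nat \<Rightarrow> complex set" where
  "Vn L N \<nu> n = (\<Union>w\<in>words N n. Psiw L \<nu> w ` V0 L N \<nu>)"

definition refl_bisector :: "complex \<Rightarrow> complex \<Rightarrow> complex \<Rightarrow> complex" where
  "refl_bisector x y z = (x + y) / 2 - ((x - y) / cnj (x - y)) * cnj (z - (x + y) / 2)"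

definition planar_simple_nested_fractal ::
    "real \<Rightarrow> nat \<Rightarrow> (nat \<Rightarrow> complex) \<Rightarrow> complex set \<Rightarrow> bool" where
  "planar_simple_nested_fractal L N \<nu> K0 \<longleftrightarrow>
     L > 1 \<and> N \<ge> 2 \<and> \<nu> 1 = 0 \<and>
     \<comment> \<open>K0 is the self-similar set (attractor) of the IFS\<close>
     compact K0 \<and> K0 \<noteq> {} \<and> K0 = (\<Union>i\<in>{1..N}. Psi L \<nu> i ` K0) \<and>
     \<comment> \<open>at least two essential fixed points\<close>
     card (V0 L N \<nu>) \<ge> 2 \<and>
     \<comment> \<open>open set condition\<close>
     (\<exists>U. open U \<and> bounded U \<and> U \<noteq> {} \<and> (\<forall>i\<in>{1..N}. Psi L \<nu> i ` U \<subseteq> U) \<and>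
        (\<forall>i\<in>{1..N}. \<forall>j\<in>{1..N}. i \<noteq> j \<longrightarrow> Psi L \<nu> i ` U \<inter> Psi L \<nu> j ` U = {})) \<and>
     \<comment> \<open>nesting\<close>
     (\<forall>n. \<forall>w\<in>words N n. \<forall>w'\<in>words N n. w \<noteq> w' \<longrightarrow>
        Psiw L \<nu> w ` K0 \<inter> Psiw L \<nu> w' ` K0 = Psiw L \<nu> w ` V0 L N \<nu> \<inter> Psiw L \<nu> w' ` V0 L N \<nu>) \<and>
     \<comment> \<open>symmetry\<close>
     (\<forall>x\<in>V0 L N \<nu>. \<forall>y\<in>V0 L N \<nu>. x \<noteq> y \<longrightarrow>
        (\<forall>n. refl_bisector x y ` Vn L N \<nu> n = Vn L N \<nu> n)) \<and>
     \<comment> \<open>connectivity of the graph of 1-cells\<close>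
     (\<forall>i\<in>{1..N}. \<forall>j\<in>{1..N}.
        (\<lambda>a b. a \<in> {1..N} \<and> b \<in> {1..N} \<and>
            Psi L \<nu> a ` V0 L N \<nu> \<inter> Psi L \<nu> b ` V0 L N \<nu> \<noteq> {})\<^sup>*\<^sup>* i j)"

definition regular_polygon :: "complex set \<Rightarrow> bool" where
  "regular_polygon V \<longleftrightarrow> (\<exists>c r \<theta>. r > 0 \<and>
     V = {c + of_real r * cis (\<theta> + 2 * pi * real j / real (card V)) | j. j < card V})"

definition scaleM :: "real \<Rightarrow> int \<Rightarrow> complex \<Rightarrow> complex" where
  "scaleM L M z = of_real (L powi M) * z"

definition KM :: "real \<Rightarrow> complex set \<Rightarrow> int \<Rightarrow> complex set" where
  "KM L K0 M = scaleM L M ` K0"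

definition VMM :: "real \<Rightarrow> nat \<Rightarrow> (nat \<Rightarrow> complex) \<Rightarrow> int \<Rightarrow> complex set" where
  "VMM L N \<nu> M = scaleM L M ` V0 L N \<nu>"

definition is_shift :: "real \<Rightarrow> nat \<Rightarrow> (nat \<Rightarrow> complex) \<Rightarrow> int \<Rightarrow> complex \<Rightarrow> bool" where
  "is_shift L N \<nu> M t \<longleftrightarrow> (\<exists>J (w :: int \<Rightarrow> nat). J \<ge> M + 1 \<and> (\<forall>j. w j \<in> {1..N}) \<and>
      t = (\<Sum>j\<in>{M+1..J}. of_real (L powi j) * \<nu> (w j)))"

definition complexes :: "real \<Rightarrow> nat \<Rightarrow> (nat \<Rightarrow> complex) \<Rightarrow> complex set \<Rightarrow> int \<Rightarrow> complex set set" where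
  "complexes L N \<nu> K0 M = {(\<lambda>z. z + t) ` KM L K0 M | t. is_shift L N \<nu> M t}"

definition VMinf :: "real \<Rightarrow> nat \<Rightarrow> (nat \<Rightarrow> complex) \<Rightarrow> int \<Rightarrow> complex set" where
  "VMinf L N \<nu> M = \<Union>{(\<lambda>z. z + t) ` VMM L N \<nu> M | t. is_shift L N \<nu> M t}"

definition barycenter :: "real \<Rightarrow> nat \<Rightarrow> (nat \<Rightarrow> complex) \<Rightarrow> int \<Rightarrow> complex" where
  "barycenter L N \<nu> M = (\<Sum>v\<in>VMM L N \<nu> M. v) / of_nat (card (VMM L N \<nu> M))"

definition rotations :: "real \<Rightarrow> nat \<Rightarrow> (nat \<Rightarrow> complex) \<Rightarrow> int \<Rightarrow> (complex \<Rightarrow> complex) set" where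
  "rotations L N \<nu> M = {(\<lambda>z. barycenter L N \<nu> M + c * (z - barycenter L N \<nu> M)) | c.
      cmod c = 1 \<and>
      (\<lambda>z. barycenter L N \<nu> M + c * (z - barycenter L N \<nu> M)) ` VMM L N \<nu> M = VMM L N \<nu> M}"

definition good_labelling :: "real \<Rightarrow> nat \<Rightarrow> (nat \<Rightarrow> complex) \<Rightarrow> int \<Rightarrow> (complex \<Rightarrow> nat) \<Rightarrow> bool" where
  "good_labelling L N \<nu> M lab \<longleftrightarrow>
     (\<forall>v\<in>VMinf L N \<nu> M. lab v \<in> {..<card (V0 L N \<nu>)}) \<and>
     bij_betw lab (VMM L N \<nu> M) {..<card (V0 L N \<nu>)} \<and>
     (\<forall>t. is_shift L N \<nu> M t \<longrightarrow>
        (\<exists>R\<in>rotations L N \<nu> M. \<forall>v\<in>(\<lambda>z. z + t) ` VMM L N \<nu> M. lab v = lab (R (v - t))))"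

definition good_labelling_property :: "real \<Rightarrow> nat \<Rightarrow> (nat \<Rightarrow> complex) \<Rightarrow> bool" where
  "good_labelling_property L N \<nu> \<longleftrightarrow> (\<exists>(M::int) lab. good_labelling L N \<nu> M lab)"

definition two_class_split :: "real \<Rightarrow> nat \<Rightarrow> (nat \<Rightarrow> complex) \<Rightarrow> complex set \<Rightarrow> bool" where
  "two_class_split L N \<nu> K0 \<longleftrightarrow>
     (let C = {\<Delta>\<in>complexes L N \<nu> K0 0. \<Delta> \<subseteq> KM L K0 1} in
      \<exists>C1 C2. C1 \<inter> C2 = {} \<and> C1 \<union> C2 = C \<and>
        (\<forall>\<Delta>\<in>C1. \<forall>\<Delta>'\<in>C. \<Delta>' \<noteq> \<Delta> \<and> \<Delta> \<inter> \<Delta>' \<noteq> {} \<longrightarrow> \<Delta>' \<in> C2) \<and>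
        (\<forall>\<Delta>\<in>C2. \<forall>\<Delta>'\<in>C. \<Delta>' \<noteq> \<Delta> \<and> \<Delta> \<inter> \<Delta>' \<noteq> {} \<longrightarrow> \<Delta>' \<in> C1))"

end

theory Submission
  imports Defs
begin

text \<open>For even k the essential fixed points form a centrally symmetric set on a circle with
  centre b. If distinct complexes V + t and V + t' met at v + t = v' + t' with v' not antipodal to
  v, then the point at relative distance 1/L on the chord from v to 2b - v' and its reflection in
  the bisector of v and v' would give a common point of the two complexes that is not a vertex,
  against nesting. So complexes touch at antipodal vertices only, and at most two of them touch at
  a point. Hence the rotations of touching complexes in a good labelling are negatives of each
  other, and splitting the unit circle into two opposite half-open arcs splits the complexes.

  Conversely, a two-colouring of the 1-cells extends to cells of all levels, and turning the
  complexes of one colour by pi gives a good labelling. For the extension, the point reflection in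
  b has to preserve or to swap the colours of all 1-cells simultaneously. It permutes the 1-cells
  because this holds for the corner cells and propagates through junctions by connectivity.\<close>

section \<open>Shifts of complexes encoded by words\<close>

text \<open>The translation left over when \<open>Psiw L \<nu> w\<close> is magnified by L^n, where
  n is the length of \<open>w\<close>. The last letter carries the factor L, so words spell the
  digit sums of \<open>is_shift\<close> with the leading digit first.\<close>

fun cell_shift :: "real \<Rightarrow> (nat \<Rightarrow> complex) \<Rightarrow> nat list \<Rightarrow> complex" where
  "cell_shift L \<nu> [] = 0"
| "cell_shift L \<nu> (i # w) = cell_shift L \<nu> w + of_real (L ^ Suc (length w)) * \<nu> i"

lemma Psiw_cell_shift:
  assumes "L \<noteq> 0"
  shows "of_real (L ^ length w) * Psiw L \<nu> w x = x + cell_shift L \<nu> w"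
proof (induction w)
  case (Cons i w)
  have "of_real (L ^ length (i # w)) * Psiw L \<nu> (i # w) x =
      of_real (L ^ length w) * Psiw L \<nu> w x + of_real (L ^ length (i # w)) * \<nu> i"
    using assms by (simp add: Psi_def ring_distribs)
  then show ?case
    using Cons.IH by simp
qed simp

lemma Psiw_eq_iff_cell_shift:
  assumes "L \<noteq> 0" "length w = length w'"
  shows "Psiw L \<nu> w x = Psiw L \<nu> w' y \<longleftrightarrow> x + cell_shift L \<nu> w = y + cell_shift L \<nu> w'"
proof -
  have "(of_real (L ^ length w) :: complex) \<noteq> 0"
    using assms by simp
  then show ?thesis
    using Psiw_cell_shift[OF assms(1), of w \<nu> x] Psiw_cell_shift[OF assms(1), of w' \<nu> y] assms(2)
    by (metis mult_cancel_left)
qed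

lemma Psiw_affine: "L \<noteq> 0 \<Longrightarrow> Psiw L \<nu> w x = Psiw L \<nu> w y + (x - y) / of_real (L ^ length w)"
  by (induction w) (simp_all add: Psi_def add_divide_distrib mult.commute)

lemma Psiw_inject: "L \<noteq> 0 \<Longrightarrow> Psiw L \<nu> w x = Psiw L \<nu> w y \<longleftrightarrow> x = y"
  using Psiw_eq_iff_cell_shift[of L w w \<nu> x y] by simp

lemma Psi_inject: "L \<noteq> 0 \<Longrightarrow> Psi L \<nu> i x = Psi L \<nu> i y \<longleftrightarrow> x = y"
  by (auto simp: Psi_def)

lemma Psiw_replicate_fixed: "Psi L \<nu> i x = x \<Longrightarrow> Psiw L \<nu> (replicate n i) x = x"
  by (induction n) auto

text \<open>Leading letters 1 act like leading zeros, so words of different lengths can be compared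
  at a common level.\<close>

lemma cell_shift_pad:
  assumes "\<nu> 1 = 0"
  shows "cell_shift L \<nu> (replicate n 1 @ w) = cell_shift L \<nu> w"
  using assms by (induction n) auto

lemma is_shift_cell_shift:
  assumes "L > 0" "N \<ge> 1" "\<nu> 1 = 0"
  shows "is_shift L N \<nu> M t \<longleftrightarrow>
    (\<exists>w. set w \<subseteq> {1..N} \<and> t = of_real (L powi M) * cell_shift L \<nu> w)"
proof
  have interval: "{M + 1..M + int (Suc n)} = insert (M + int (Suc n)) {M + 1..M + int n}" for n
    by auto
  have pow: "(of_real (L powi (M + int n)) :: complex) = of_real (L powi M) * of_real (L ^ n)" for n
    using assms(1) by (simp add: power_int_add)
  {
    assume "is_shift L N \<nu> M t"
    then obtain J f where J: "J \<ge> M + 1" and f: "\<And>j. f j \<in> {1..N}"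
      and t: "t = (\<Sum>j\<in>{M+1..J}. of_real (L powi j) * \<nu> (f j))"
      unfolding is_shift_def by blast
    have "\<exists>w. length w = n \<and> set w \<subseteq> {1..N} \<and>
      (\<Sum>j\<in>{M+1..M + int n}. of_real (L powi j) * \<nu> (f j)) = of_real (L powi M) * cell_shift L \<nu> w"
      for n
    proof (induction n)
      case 0
      then show ?case by auto
    next
      case (Suc n)
      then obtain w where w: "length w = n" "set w \<subseteq> {1..N}"
        "(\<Sum>j\<in>{M+1..M + int n}. of_real (L powi j) * \<nu> (f j)) = of_real (L powi M) * cell_shift L \<nu> w"
        by blast
      have "(\<Sum>j\<in>{M+1..M + int (Suc n)}. of_real (L powi j) * \<nu> (f j)) =
          of_real (L powi (M + int (Suc n))) * \<nu> (f (M + int (Suc n))) + of_real (L powi M) * cell_shift L \<nu> w"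
        unfolding interval by (subst sum.insert, simp, simp, simp only: w(3))
      also have "\<dots> = of_real (L powi M) * cell_shift L \<nu> (f (M + int (Suc n)) # w)"
        unfolding pow using w(1) by (simp add: algebra_simps)
      finally have "(\<Sum>j\<in>{M+1..M + int (Suc n)}. of_real (L powi j) * \<nu> (f j)) =
          of_real (L powi M) * cell_shift L \<nu> (f (M + int (Suc n)) # w)" .
      moreover have "length (f (M + int (Suc n)) # w) = Suc n" "set (f (M + int (Suc n)) # w) \<subseteq> {1..N}"
        using w f by auto
      ultimately show ?case
        by (intro exI[of _ "f (M + int (Suc n)) # w"] conjI)
    qed
    from this[of "nat (J - M)"] show "\<exists>w. set w \<subseteq> {1..N} \<and> t = of_real (L powi M) * cell_shift L \<nu> w"
      using J t by auto
  }
  assume "\<exists>w. set w \<subseteq> {1..N} \<and> t = of_real (L powi M) * cell_shift L \<nu> w"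
  then obtain w where w: "set w \<subseteq> {1..N}" "t = of_real (L powi M) * cell_shift L \<nu> w"
    by blast
  have "\<exists>f :: int \<Rightarrow> nat. (\<forall>j. f j \<in> {1..N}) \<and>
    (\<Sum>j\<in>{M+1..M + int (length u)}. of_real (L powi j) * \<nu> (f j)) = of_real (L powi M) * cell_shift L \<nu> u"
    if "set u \<subseteq> {1..N}" for u
    using that
  proof (induction u)
    case Nil
    then show ?case using assms(2) by (auto intro!: exI[of _ "\<lambda>_. 1"])
  next
    case (Cons i u)
    then obtain f :: "int \<Rightarrow> nat" where f: "\<And>j. f j \<in> {1..N}"
      "(\<Sum>j\<in>{M+1..M + int (length u)}. of_real (L powi j) * \<nu> (f j)) = of_real (L powi M) * cell_shift L \<nu> u"
      by auto
    define g where "g = f(M + int (Suc (length u)) := i)"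
    have g: "g j \<in> {1..N}" for j
      using f(1) Cons.prems by (auto simp: g_def)
    have "(\<Sum>j\<in>{M+1..M + int (length u)}. of_real (L powi j) * \<nu> (g j)) = of_real (L powi M) * cell_shift L \<nu> u"
      unfolding f(2)[symmetric] by (rule sum.cong) (auto simp: g_def)
    then have "(\<Sum>j\<in>{M+1..M + int (Suc (length u))}. of_real (L powi j) * \<nu> (g j)) =
        of_real (L powi (M + int (Suc (length u)))) * \<nu> i + of_real (L powi M) * cell_shift L \<nu> u"
      unfolding interval by (subst sum.insert) (auto simp: g_def)
    also have "\<dots> = of_real (L powi M) * cell_shift L \<nu> (i # u)"
      unfolding pow by (simp add: algebra_simps)
    finally show ?case
      using g by (intro exI[of _ g]) auto
  qed
  \<comment> \<open>The extra leading 1 makes the word nonempty, as \<open>J \<ge> M + 1\<close>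
    requires, and leaves the shift unchanged.\<close>
  from this[of "1 # w"] obtain f :: "int \<Rightarrow> nat" where "\<And>j. f j \<in> {1..N}"
    "(\<Sum>j\<in>{M+1..M + int (length (1 # w))}. of_real (L powi j) * \<nu> (f j)) = t"
    using w assms by auto
  then show "is_shift L N \<nu> M t"
    unfolding is_shift_def by (intro exI[of _ "M + int (length (1 # w))"] exI[of _ f]) auto
qed

section \<open>Chords of a circle\<close>

text \<open>Thales: the chords from v to v' and from v to the antipode 2b - v' are perpendicular.
  The equation says that the real part of (v - v') * cnj (2b - v - v') vanishes.\<close>

lemma circle_orthogonal_chords:
  fixes v v' b :: complex
  assumes "cmod (v - b) = cmod (v' - b)"
  shows "(v - v') * cnj (2 * b - v - v') = - (cnj (v - v') * (2 * b - v - v'))"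
proof -
  have "(v - b) * cnj (v - b) = (v' - b) * cnj (v' - b)"
    using assms by (metis complex_norm_square)
  moreover have "(v - v') * cnj (2 * b - v - v') + cnj (v - v') * (2 * b - v - v') =
      2 * ((v' - b) * cnj (v' - b) - (v - b) * cnj (v - b))"
    by (simp add: algebra_simps)
  ultimately show ?thesis
    by (simp add: eq_neg_iff_add_eq_0)
qed

text \<open>The perpendicular bisector of a chord passes through the centre, so b can replace the
  midpoint as base point.\<close>

lemma refl_bisector_through_center:
  fixes v v' b z :: complex
  assumes "cmod (v - b) = cmod (v' - b)" "v \<noteq> v'"
  shows "refl_bisector v v' z = b - (v - v') / cnj (v - v') * cnj (z - b)"
proof -
  define a where "a = (v - v') / cnj (v - v')"
  have "a * cnj (2 * b - v - v') = - (2 * b - v - v')"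
    using circle_orthogonal_chords[OF assms(1)] assms(2) by (simp add: a_def divide_simps mult.commute)
  moreover have "cnj (z - (v + v') / 2) = cnj (z - b) + cnj (2 * b - v - v') / 2"
    by (simp add: diff_divide_distrib add_divide_distrib)
  ultimately have "a * cnj (z - (v + v') / 2) = a * cnj (z - b) + (- (2 * b - v - v')) / 2"
    by (simp only: distrib_left times_divide_eq_right)
  then have "refl_bisector v v' z = (v + v') / 2 - (a * cnj (z - b) + (- (2 * b - v - v')) / 2)"
    by (simp only: refl_bisector_def a_def)
  then show ?thesis
    unfolding a_def by (simp add: diff_divide_distrib add_divide_distrib)
qed


text \<open>Strict convexity of the disc, from |p + s(q - p)|^2 = (1 - s)|p|^2 + s|q|^2 - s(1 - s)|q
  - p|^2 in coordinates.\<close>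

lemma circle_chord_interior:
  fixes v w b :: complex
  assumes "cmod (v - b) = r" "cmod (w - b) = r" "v \<noteq> w" "0 < s" "s < 1"
  shows "cmod (v + of_real s * (w - v) - b) \<noteq> r"
proof
  assume *: "cmod (v + of_real s * (w - v) - b) = r"
  define p q where "p = v - b" and "q = w - b"
  have sq: "(cmod z)\<^sup>2 = (Re z)\<^sup>2 + (Im z)\<^sup>2" for z
    by (rule cmod_power2)
  have "v + of_real s * (w - v) - b = p + of_real s * (q - p)"
    by (simp add: p_def q_def)
  then have 1: "(Re p + s * (Re q - Re p))\<^sup>2 + (Im p + s * (Im q - Im p))\<^sup>2 = r\<^sup>2"
    using * sq[of "p + of_real s * (q - p)"] by simp
  have 2: "(Re p)\<^sup>2 + (Im p)\<^sup>2 = r\<^sup>2" "(Re q)\<^sup>2 + (Im q)\<^sup>2 = r\<^sup>2"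
    using assms(1,2) sq[of p] sq[of q] by (auto simp: p_def q_def)
  have "s * (1 - s) * ((Re q - Re p)\<^sup>2 + (Im q - Im p)\<^sup>2) =
      (1 - s) * ((Re p)\<^sup>2 + (Im p)\<^sup>2) + s * ((Re q)\<^sup>2 + (Im q)\<^sup>2) -
      ((Re p + s * (Re q - Re p))\<^sup>2 + (Im p + s * (Im q - Im p))\<^sup>2)"
    by (simp add: power2_eq_square algebra_simps)
  also have "\<dots> = 0"
    unfolding 1 2 by (simp add: algebra_simps)
  finally have "(Re q - Re p)\<^sup>2 + (Im q - Im p)\<^sup>2 = 0"
    using assms(4,5) by simp
  then have "p = q"
    by (simp add: sum_power2_eq_zero_iff complex_eq_iff)
  then show False
    using assms(3) by (simp add: p_def q_def)
qed

section \<open>The fractal with a centrally symmetric vertex set\<close>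

text \<open>An even regular polygon with centre b supplies \<open>circle\<close> and
  \<open>antipode\<close>; three vertices guarantee two that are neither equal nor
  antipodal.\<close>

locale central_nested_fractal =
  fixes L :: real and N :: nat and \<nu> :: "nat \<Rightarrow> complex" and K0 :: "complex set"
    and b :: complex and r :: real
  assumes snf: "planar_simple_nested_fractal L N \<nu> K0"
    and circle: "v \<in> V0 L N \<nu> \<Longrightarrow> cmod (v - b) = r"
    and antipode: "v \<in> V0 L N \<nu> \<Longrightarrow> 2 * b - v \<in> V0 L N \<nu>"
    and card_V0: "card (V0 L N \<nu>) \<ge> 3"
begin

abbreviation V :: "complex set" where "V \<equiv> V0 L N \<nu>"

lemma L_gt_1: "L > 1" and N_ge_2: "N \<ge> 2" and nu_1: "\<nu> 1 = 0"
  and compact_K: "compact K0" and K_nonempty: "K0 \<noteq> {}"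
  and K_eq: "K0 = (\<Union>i\<in>{1..N}. Psi L \<nu> i ` K0)"
  and nesting_all: "\<forall>n. \<forall>w\<in>words N n. \<forall>w'\<in>words N n. w \<noteq> w' \<longrightarrow>
    Psiw L \<nu> w ` K0 \<inter> Psiw L \<nu> w' ` K0 = Psiw L \<nu> w ` V \<inter> Psiw L \<nu> w' ` V"
  and symmetry_all: "\<forall>x\<in>V. \<forall>y\<in>V. x \<noteq> y \<longrightarrow>
    (\<forall>n. refl_bisector x y ` Vn L N \<nu> n = Vn L N \<nu> n)"
  and connectivity: "\<forall>i\<in>{1..N}. \<forall>j\<in>{1..N}.
    (\<lambda>a b. a \<in> {1..N} \<and> b \<in> {1..N} \<and> Psi L \<nu> a ` V \<inter> Psi L \<nu> b ` V \<noteq> {})\<^sup>*\<^sup>* i j"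
  using snf unfolding planar_simple_nested_fractal_def by - (elim conjE, assumption)+

lemma L_nz [simp]: "L \<noteq> 0"
  using L_gt_1 by simp

lemma nesting:
  assumes "w \<in> words N n" "w' \<in> words N n" "w \<noteq> w'"
  shows "Psiw L \<nu> w ` K0 \<inter> Psiw L \<nu> w' ` K0 = Psiw L \<nu> w ` V \<inter> Psiw L \<nu> w' ` V"
  using nesting_all assms by blast

lemma nesting1:
  assumes "i \<in> {1..N}" "j \<in> {1..N}" "i \<noteq> j"
  shows "Psi L \<nu> i ` K0 \<inter> Psi L \<nu> j ` K0 = Psi L \<nu> i ` V \<inter> Psi L \<nu> j ` V"
  using nesting[of "[i]" 1 "[j]"] assms by (simp add: words_def)

lemma refl_Vn:
  assumes "x \<in> V" "y \<in> V" "x \<noteq> y" "z \<in> Vn L N \<nu> n"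
  shows "refl_bisector x y z \<in> Vn L N \<nu> n"
  using symmetry_all assms by blast

lemma finite_V: "finite V"
  using card_V0 card.infinite by force

lemma V_fixed: "v \<in> V \<Longrightarrow> \<exists>i\<in>{1..N}. Psi L \<nu> i v = v"
  unfolding V0_def by blast

lemma Psi_in_K: "i \<in> {1..N} \<Longrightarrow> z \<in> K0 \<Longrightarrow> Psi L \<nu> i z \<in> K0"
  by (subst K_eq) blast

lemma Psiw_in_K: "set w \<subseteq> {1..N} \<Longrightarrow> z \<in> K0 \<Longrightarrow> Psiw L \<nu> w z \<in> K0"
  by (induction w) (auto intro: Psi_in_K)

lemma inverse_powers_L_tendsto: "(\<lambda>n. z + d / of_real (L ^ n) :: complex) \<longlonglongrightarrow> z"
proof -
  have "cmod (of_real (1 / L)) < 1"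
    unfolding norm_of_real using L_gt_1 by simp
  then have "(\<lambda>n. of_real (1 / L) ^ n :: complex) \<longlonglongrightarrow> 0"
    by (rule LIMSEQ_power_zero)
  then have "(\<lambda>n. z + d * of_real (1 / L) ^ n :: complex) \<longlonglongrightarrow> z + d * 0"
    by (intro tendsto_add tendsto_mult tendsto_const)
  moreover have "of_real (1 / L) ^ n = (1 :: complex) / of_real (L ^ n)" for n
    by (simp only: of_real_divide of_real_1 power_one_over of_real_power)
  ultimately show ?thesis
    by (simp only: times_divide_eq_right mult_1_right mult_zero_right add_0_right)
qed

lemma Psiw_replicate_eq:
  assumes "Psi L \<nu> i v = v"
  shows "Psiw L \<nu> (replicate n i) z = v + (z - v) / of_real (L ^ n)"
  using Psiw_affine[OF L_nz, of \<nu> "replicate n i" z v] Psiw_replicate_fixed[OF assms]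
  by (metis length_replicate)

text \<open>Iterating the contraction that fixes v from any point of K0 gives points of K0
  converging to v, and K0 is closed.\<close>

lemma V_subset_K: "V \<subseteq> K0"
proof
  fix v assume "v \<in> V"
  then obtain i where i: "i \<in> {1..N}" "Psi L \<nu> i v = v"
    using V_fixed by blast
  obtain z where z: "z \<in> K0"
    using K_nonempty by blast
  have "v + (z - v) / of_real (L ^ n) \<in> K0" for n
    unfolding Psiw_replicate_eq[OF i(2), symmetric] using i(1) z by (intro Psiw_in_K) auto
  with inverse_powers_L_tendsto[of v "z - v"] compact_K[THEN compact_imp_closed]
  show "v \<in> K0"
    by (meson closed_sequentially)
qed

lemma Vn_subset_K: "Vn L N \<nu> n \<subseteq> K0"
  unfolding Vn_def words_def using V_subset_K Psiw_in_K by auto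

text \<open>The point is the image of w under the n-th iterate of the map fixing v, and it lies
  strictly inside the circle. This provides non-vertex points of K0 arbitrarily close to v.\<close>

lemma chord_point:
  assumes "v \<in> V" "w \<in> V" "v \<noteq> w" "n > 0"
  shows "v + (w - v) / of_real (L ^ n) \<in> Vn L N \<nu> n"
    and "v + (w - v) / of_real (L ^ n) \<notin> V"
proof -
  obtain i where i: "i \<in> {1..N}" "Psi L \<nu> i v = v"
    using V_fixed assms by blast
  have "replicate n i \<in> words N n"
    using i(1) by (auto simp: words_def)
  then show "v + (w - v) / of_real (L ^ n) \<in> Vn L N \<nu> n"
    unfolding Psiw_replicate_eq[OF i(2), symmetric] Vn_def using assms(2) by blast
  have "0 < 1 / L ^ n" "1 / L ^ n < 1"
    using L_gt_1 assms(4) by (auto simp: one_less_power)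
  from circle_chord_interior[OF circle[OF assms(1)] circle[OF assms(2)] assms(3) this]
  show "v + (w - v) / of_real (L ^ n) \<notin> V"
    using circle by auto
qed

lemma r_pos: "r > 0"
proof (rule ccontr)
  assume "\<not> r > 0"
  then have "V \<subseteq> {b}"
    using circle by (metis eq_iff_diff_eq_0 norm_ge_zero norm_le_zero_iff not_le singletonI subsetI)
  then show False
    using card_V0 card_mono[of "{b}" V] by simp
qed

lemma antipode_neq: "v \<in> V \<Longrightarrow> 2 * b - v \<noteq> v"
proof
  assume "v \<in> V" and "2 * b - v = v"
  then have "2 * b = 2 * v"
    by (simp add: algebra_simps)
  then show False
    using circle[OF \<open>v \<in> V\<close>] r_pos by simp
qed

lemma nonantipodal_pair:
  obtains v v' where "v \<in> V" "v' \<in> V" "v \<noteq> v'" "v' \<noteq> 2 * b - v"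
proof -
  obtain v where v: "v \<in> V"
    using card_V0 by fastforce
  have "\<not> V \<subseteq> {v, 2 * b - v}"
  proof
    assume "V \<subseteq> {v, 2 * b - v}"
    then have "card V \<le> card {v, 2 * b - v}"
      by (intro card_mono) auto
    also have "\<dots> \<le> 2"
      by (simp add: card_insert_if)
    finally show False
      using card_V0 by simp
  qed
  then show ?thesis
    using that v by blast
qed

section \<open>Junctions of cells are antipodal\<close>

text \<open>The displacement from v to 2b - v' is perpendicular to v - v', hence parallel to the
  bisector, so the reflection keeps it and exchanges the base points v and v'.\<close>

lemma refl_chord:
  assumes "v \<in> V" "v' \<in> V" "v \<noteq> v'"
  shows "refl_bisector v v' (v + (2 * b - v' - v) / of_real c) = v' + (2 * b - v' - v) / of_real c"
proof -
  define u m where "u = v - v'" and "m = 2 * b - v - v'"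
  have u: "u \<noteq> 0" "cnj u \<noteq> 0"
    using assms by (auto simp: u_def)
  have "u * cnj m = - (cnj u * m)"
    unfolding u_def m_def using circle_orthogonal_chords assms circle by metis
  then have am: "u / cnj u * cnj m = - m"
    using u by (simp add: divide_simps mult.commute)
  have "v + (2 * b - v' - v) / of_real c - (v + v') / 2 = u / 2 + m / of_real c"
    by (simp add: u_def m_def diff_divide_distrib add_divide_distrib)
  then have "refl_bisector v v' (v + (2 * b - v' - v) / of_real c) =
      (v + v') / 2 - u / cnj u * cnj (u / 2 + m / of_real c)"
    by (simp add: refl_bisector_def u_def)
  also have "u / cnj u * cnj (u / 2 + m / of_real c) = u / cnj u * cnj u / 2 + u / cnj u * cnj m / of_real c"
    by (simp add: ring_distribs)
  also have "\<dots> = u / 2 - m / of_real c"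
    unfolding am using u by simp
  also have "(v + v') / 2 - (u / 2 - m / of_real c) = v' + (2 * b - v' - v) / of_real c"
    by (simp add: u_def m_def diff_divide_distrib add_divide_distrib)
  finally show ?thesis .
qed

lemma shared_vertex_antipodal:
  assumes "w \<in> words N n" "w' \<in> words N n" "w \<noteq> w'" "v \<in> V" "v' \<in> V"
    and eq: "Psiw L \<nu> w v = Psiw L \<nu> w' v'"
  shows "v' = 2 * b - v"
proof (rule ccontr)
  assume neq: "v' \<noteq> 2 * b - v"
  \<comment> \<open>The two cells are translates of each other, so points with equal offsets from v
    and v' have the same image; nesting makes that image a vertex.\<close>
  have no_common: "p \<in> V" if "p \<in> K0" "p' \<in> K0" "p - v = p' - v'" for p p'
  proof -
    have "Psiw L \<nu> w p = Psiw L \<nu> w' p'"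
      using Psiw_affine[OF L_nz, of \<nu> w p v] Psiw_affine[OF L_nz, of \<nu> w' p' v'] eq that(3) assms(1,2)
      by (simp add: words_def)
    then have "Psiw L \<nu> w p \<in> Psiw L \<nu> w ` V"
      using nesting[OF assms(1-3)] that by blast
    then show ?thesis
      by (auto simp: Psiw_inject[OF L_nz])
  qed
  have "2 * b - v' \<in> V" "v \<noteq> 2 * b - v'"
    using neq assms antipode by auto
  note p = chord_point[OF \<open>v \<in> V\<close> this zero_less_one]
  \<comment> \<open>\<open>p\<close> lies on the chord from v to 2b - v', and \<open>p'\<close> has
    the same offset from v'. For v = v' they coincide; otherwise \<open>p'\<close> is the mirror
    image of \<open>p\<close> in the bisector.\<close>
  define p where "p = v + (2 * b - v' - v) / of_real (L ^ 1)"
  define p' where "p' = v' + (2 * b - v' - v) / of_real (L ^ 1)"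
  have "p' \<in> K0"
  proof (cases "v = v'")
    case True
    then show ?thesis
      using p(1) Vn_subset_K by (auto simp: p'_def)
  next
    case False
    then show ?thesis
      using refl_Vn[OF assms(4,5) False p(1)] Vn_subset_K
      unfolding refl_chord[OF assms(4,5) False] p'_def by blast
  qed
  moreover have "p \<in> K0" "p - v = p' - v'"
    using p(1) Vn_subset_K by (auto simp: p_def p'_def)
  ultimately show False
    using no_common p(2) unfolding p_def by blast
qed

lemma shared_vertex_antipodal1:
  assumes "i \<in> {1..N}" "j \<in> {1..N}" "i \<noteq> j" "v \<in> V" "v' \<in> V" "Psi L \<nu> i v = Psi L \<nu> j v'"
  shows "v' = 2 * b - v"
  using shared_vertex_antipodal[of "[i]" 1 "[j]" v v'] assms by (auto simp: words_def)

text \<open>Three vertices cannot be pairwise antipodal: two antipodes of v are equal, and no vertex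
  is its own antipode.\<close>

lemma at_most_two_cells:
  assumes "w \<in> words N n" "w' \<in> words N n" "w'' \<in> words N n" "w \<noteq> w'" "w \<noteq> w''" "w' \<noteq> w''"
    and "v \<in> V" "v' \<in> V" "v'' \<in> V" "Psiw L \<nu> w v = Psiw L \<nu> w' v'"
  shows "Psiw L \<nu> w v \<noteq> Psiw L \<nu> w'' v''"
proof
  assume "Psiw L \<nu> w v = Psiw L \<nu> w'' v''"
  then have "v'' = 2 * b - v" "v' = 2 * b - v" "v'' = 2 * b - v'"
    using shared_vertex_antipodal assms by metis+
  then show False
    using antipode_neq assms by metis
qed

text \<open>A second 1-cell at an essential fixed point x = Psi i x would produce three 2-cells at x.\<close>

lemma corner_cell_unique:
  assumes "i \<in> {1..N}" "j \<in> {1..N}" "x \<in> V" "y \<in> V" "Psi L \<nu> i x = x" "Psi L \<nu> j y = x"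
  shows "j = i"
proof (rule ccontr)
  assume "j \<noteq> i"
  obtain m where "m \<in> {1..N}" "Psi L \<nu> m y = y"
    using V_fixed assms by blast
  \<comment> \<open>The three 2-cells are \<open>[i,i]\<close>, \<open>[i,j]\<close> and
    \<open>[j,m]\<close>: the map i fixes x, the map j sends y to x, and the map m fixes y.\<close>
  then show False
    using at_most_two_cells[of "[i,i]" 2 "[i,j]" "[j,m]" x y y] assms \<open>j \<noteq> i\<close>
    by (auto simp: words_def)
qed

text \<open>By nesting, x is a vertex of the outermost 1-cell, which therefore is the corner cell i.
  Since the map i fixes x, the argument repeats for the rest of the word.\<close>

lemma corner_word_unique:
  assumes "set u \<subseteq> {1..N}" "v \<in> V" "x \<in> V" "i \<in> {1..N}" "Psi L \<nu> i x = x" "Psiw L \<nu> u v = x"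
  shows "u = replicate (length u) i"
  using assms(1,6)
proof (induction u)
  case (Cons j u)
  have K: "Psiw L \<nu> u v \<in> K0" "x \<in> K0"
    using Cons.prems assms V_subset_K by (auto intro!: Psiw_in_K)
  have "j = i"
  proof (rule ccontr)
    assume "j \<noteq> i"
    have "x \<in> Psi L \<nu> j ` K0" "x \<in> Psi L \<nu> i ` K0"
      using K Cons.prems(2) assms(5) by (auto simp: image_iff) metis
    then have "x \<in> Psi L \<nu> j ` V"
      using nesting1[of j i] \<open>j \<noteq> i\<close> Cons.prems assms by auto
    then obtain y where "y \<in> V" "Psi L \<nu> j y = x"
      by auto
    then show False
      using corner_cell_unique[of i j x y] assms Cons.prems \<open>j \<noteq> i\<close> by simp
  qed
  then have "Psiw L \<nu> u v = x"
    using Cons.prems(2) assms(5) Psi_inject[OF L_nz] by (metis Psiw.simps(2))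
  then show ?case
    using Cons \<open>j = i\<close> by simp
qed simp

section \<open>Invariance under the point reflection\<close>

text \<open>The point reflection is the product of the reflections in the two axes of a rectangle
  with vertices v, v', 2b - v, 2b - v'.\<close>

lemma point_refl_Vn:
  assumes "z \<in> Vn L N \<nu> n"
  shows "2 * b - z \<in> Vn L N \<nu> n"
proof -
  obtain v v' where v: "v \<in> V" "v' \<in> V" "v \<noteq> v'" "v' \<noteq> 2 * b - v"
    using nonantipodal_pair .
  define w where "w = 2 * b - v'"
  have w: "w \<in> V" "v \<noteq> w"
    using v antipode by (auto simp: w_def)
  define u m where "u = v - v'" and "m = v - w"
  have um: "u \<noteq> 0" "m \<noteq> 0"
    using v w by (auto simp: u_def m_def)
  have "u * cnj (- m) = - (cnj u * (- m))"
    using circle_orthogonal_chords[of v b v'] circle v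
    by (simp add: u_def m_def w_def algebra_simps)
  then have "- (u * cnj m) = cnj u * m"
    by simp
  then have orth: "u * cnj m = - (cnj u * m)"
    by (metis minus_minus)
  have "refl_bisector v w z = b - m / cnj m * cnj (z - b)"
    unfolding m_def using refl_bisector_through_center circle v w by metis
  moreover have "refl_bisector v v' y = b - u / cnj u * cnj (y - b)" for y
    unfolding u_def using refl_bisector_through_center circle v by metis
  \<comment> \<open>The composite fixes b and has linear factor (u * cnj m) / (cnj u * m), which is
    -1 because u and m are perpendicular.\<close>
  ultimately have "refl_bisector v v' (refl_bisector v w z) =
      b + u / cnj u * (cnj m / m * (z - b))"
    by simp
  also have "\<dots> = b + (u * cnj m) / (cnj u * m) * (z - b)"
    by simp
  also have "\<dots> = 2 * b - z"
    unfolding orth using um by simp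
  finally show ?thesis
    using refl_Vn[OF v(1-3) refl_Vn[OF v(1) w assms]] by simp
qed

lemma K_in_cell: "z \<in> K0 \<Longrightarrow> \<exists>w\<in>words N n. z \<in> Psiw L \<nu> w ` K0"
proof (induction n arbitrary: z)
  case 0
  then show ?case by (auto simp: words_def)
next
  case (Suc n)
  then obtain i y where iy: "i \<in> {1..N}" "y \<in> K0" "z = Psi L \<nu> i y"
    using K_eq by blast
  then obtain w where "w \<in> words N n" "y \<in> Psiw L \<nu> w ` K0"
    using Suc by blast
  then show ?case
    using iy by (intro bexI[of _ "i # w"]) (auto simp: words_def)
qed

text \<open>The symmetry axiom speaks of the vertex sets \<open>Vn\<close>. Their union is dense in
  the closed set K0, since n-cells have diameter at most 2B/L^n, so the invariance passes to the
  limit.\<close>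

lemma point_refl_K:
  assumes "z \<in> K0"
  shows "2 * b - z \<in> K0"
proof -
  obtain v where v: "v \<in> V"
    using card_V0 by fastforce
  obtain B where B: "\<And>x. x \<in> K0 \<Longrightarrow> cmod x \<le> B"
    using compact_imp_bounded[OF compact_K] unfolding bounded_iff by blast
  have "\<exists>p\<in>Vn L N \<nu> n. cmod (p - z) \<le> 2 * B / L ^ n" for n
  proof -
    obtain w y where w: "w \<in> words N n" "y \<in> K0" "z = Psiw L \<nu> w y"
      using K_in_cell[OF assms] by blast
    then have "Psiw L \<nu> w v - z = (v - y) / of_real (L ^ n)"
      using Psiw_affine[OF L_nz, of \<nu> w v y] by (simp add: words_def)
    then have "cmod (Psiw L \<nu> w v - z) = cmod (v - y) / L ^ n"
      using L_gt_1 by (simp add: norm_divide norm_power)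
    also have "cmod (v - y) \<le> 2 * B"
      using norm_triangle_ineq4[of v y] B[of v] B[OF w(2)] v V_subset_K by (simp add: subset_iff)
    finally have "cmod (Psiw L \<nu> w v - z) \<le> 2 * B / L ^ n"
      using L_gt_1 by (simp add: divide_right_mono)
    moreover have "Psiw L \<nu> w v \<in> Vn L N \<nu> n"
      using w(1) v unfolding Vn_def by blast
    ultimately show ?thesis
      by blast
  qed
  then obtain p where p: "\<And>n. p n \<in> Vn L N \<nu> n" "\<And>n. cmod (p n - z) \<le> 2 * B / L ^ n"
    by metis
  have "(\<lambda>n. 2 * B / L ^ n) \<longlonglongrightarrow> 0"
    using L_gt_1 by (rule LIMSEQ_divide_realpow_zero)
  moreover have "\<forall>\<^sub>F n in sequentially. cmod (p n - z) \<le> 2 * B / L ^ n"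
    using p(2) by (intro always_eventually allI)
  ultimately have "(\<lambda>n. p n - z) \<longlonglongrightarrow> 0"
    by (rule Lim_null_comparison[rotated])
  then have "p \<longlonglongrightarrow> z"
    by (simp add: LIM_zero_iff)
  then have "(\<lambda>n. 2 * b - p n) \<longlonglongrightarrow> 2 * b - z"
    by (intro tendsto_diff tendsto_const)
  moreover have "2 * b - p n \<in> K0" for n
    using point_refl_Vn[OF p(1)] Vn_subset_K by blast
  ultimately show ?thesis
    using compact_K[THEN compact_imp_closed] by (meson closed_sequentially)
qed

section \<open>Mirror images of 1-cells\<close>

text \<open>The point reflection in b carries cell i onto cell m. This is a relation because the
  existence of m is established only along junctions.\<close>

definition mirror :: "nat \<Rightarrow> nat \<Rightarrow> bool" where
  "mirror i m \<longleftrightarrow> m \<in> {1..N} \<and> \<nu> m = 2 * b - 2 * b / of_real L - \<nu> i"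

lemma mirror_iff_Psi: "mirror i m \<longleftrightarrow> m \<in> {1..N} \<and> Psi L \<nu> m (2 * b - x) = 2 * b - Psi L \<nu> i x"
  by (auto simp: mirror_def Psi_def field_simps)

lemma compact_Psi_image: "compact (Psi L \<nu> i ` K0)"
  unfolding Psi_def by (intro compact_continuous_image continuous_intros compact_K) simp

text \<open>If the mirror image of a junction q of the 1-cells i and j were contained in only one 1-cell,
  then near q the cell j would be contained in the cell i.\<close>

lemma mirror_junction:
  assumes m: "mirror i m" and ij: "i \<in> {1..N}" "j \<in> {1..N}" "i \<noteq> j"
    and x: "x \<in> V" "x' \<in> V" "Psi L \<nu> i x = Psi L \<nu> j x'"
  shows "\<exists>m'\<in>{1..N}. m' \<noteq> m \<and> 2 * b - Psi L \<nu> i x \<in> Psi L \<nu> m' ` K0"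
proof (rule ccontr)
  assume contra: "\<not> ?thesis"
  define C where "C = (\<Union>m'\<in>{1..N} - {m}. Psi L \<nu> m' ` K0)"
  have "closed C"
    unfolding C_def using compact_imp_closed[OF compact_Psi_image] by (intro closed_UN) simp_all
  have neq: "x' \<noteq> x"
    using shared_vertex_antipodal1[OF ij x] antipode_neq[OF x(1)] by simp
  \<comment> \<open>The points \<open>a n\<close> tend to the junction inside cell j without being
    vertices of that cell.\<close>
  define z a where "z n = x' + (x - x') / of_real (L ^ Suc n)" and "a n = Psi L \<nu> j (z n)" for n
  have z: "z n \<in> K0" "z n \<notin> V" for n
    using chord_point[OF x(2,1) neq zero_less_Suc, of n] Vn_subset_K unfolding z_def by blast+
  have "z \<longlonglongrightarrow> x'"
    using inverse_powers_L_tendsto[of x' "x - x'", THEN LIMSEQ_Suc] unfolding z_def .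
  then have "(\<lambda>n. 2 * b - a n) \<longlonglongrightarrow> 2 * b - Psi L \<nu> j x'"
    unfolding a_def Psi_def by (intro tendsto_intros) auto
  moreover have "2 * b - Psi L \<nu> j x' \<in> - C"
    using contra x(3) unfolding C_def by auto
  \<comment> \<open>The closed set \<open>C\<close> misses the mirrored junction, so eventually the
    mirror images of \<open>a n\<close> can lie only in cell m; then \<open>a n\<close> itself lies
    in cell i.\<close>
  ultimately have "\<forall>\<^sub>F n in sequentially. 2 * b - a n \<in> - C"
    using \<open>closed C\<close> topological_tendstoD by blast
  then obtain n where n: "2 * b - a n \<notin> C"
    using eventually_sequentially by auto
  have "2 * b - a n \<in> K0"
    unfolding a_def using z ij by (intro point_refl_K Psi_in_K)
  then obtain m' y where y: "m' \<in> {1..N}" "y \<in> K0" "2 * b - a n = Psi L \<nu> m' y"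
    using K_eq by blast
  with n have "m' = m"
    unfolding C_def by auto
  have "Psi L \<nu> m y = 2 * b - Psi L \<nu> i (2 * b - y)"
    using m mirror_iff_Psi[of i m "2 * b - y"] by simp
  then have "a n = Psi L \<nu> i (2 * b - y)"
    using y(3) \<open>m' = m\<close> by (simp add: algebra_simps)
  then have "a n \<in> Psi L \<nu> i ` K0 \<inter> Psi L \<nu> j ` K0"
    using point_refl_K[OF y(2)] z unfolding a_def by blast
  then have "a n \<in> Psi L \<nu> j ` V"
    using nesting1[OF ij] by blast
  then show False
    using z(2) unfolding a_def by (auto simp: Psi_inject)
qed

text \<open>The second cell m' at the mirrored junction has it as a vertex by nesting, and
  antipodality identifies this vertex as the image of 2b - x'. One such incidence fixes the
  translation, so m' mirrors j.\<close>

lemma mirror_step: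
  assumes m: "mirror i m" and ij: "i \<in> {1..N}" "j \<in> {1..N}" "i \<noteq> j"
    and x: "x \<in> V" "x' \<in> V" "Psi L \<nu> i x = Psi L \<nu> j x'"
  shows "\<exists>m'. mirror j m' \<and> m' \<noteq> m \<and> Psi L \<nu> m (2 * b - x) = Psi L \<nu> m' (2 * b - x')"
proof -
  have m1: "m \<in> {1..N}" "Psi L \<nu> m (2 * b - x) = 2 * b - Psi L \<nu> i x"
    using m mirror_iff_Psi by blast+
  obtain m' where m': "m' \<in> {1..N}" "m' \<noteq> m" "2 * b - Psi L \<nu> i x \<in> Psi L \<nu> m' ` K0"
    using mirror_junction[OF assms] by blast
  moreover have "2 * b - Psi L \<nu> i x \<in> Psi L \<nu> m ` K0"
    using m1 x(1) antipode V_subset_K by (metis image_eqI subsetD)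
  ultimately obtain y where y: "y \<in> V" "Psi L \<nu> m (2 * b - x) = Psi L \<nu> m' y"
    using nesting1[OF m'(1) m1(1) m'(2)] m1(2) by auto
  have "y = 2 * b - x'"
    using shared_vertex_antipodal1[OF m1(1) m'(1) m'(2)[symmetric] antipode[OF x(1)] y]
      shared_vertex_antipodal1[OF ij x] by simp
  then show ?thesis
    using y(2) m' m1(2) x(3) mirror_iff_Psi[of j m' x'] by auto
qed

text \<open>A mirror image of the corner cell at x has 2b - x as a vertex, and only one 1-cell does.
  This starts the propagation along junctions.\<close>

lemma mirror_corner:
  assumes "i \<in> {1..N}" "j \<in> {1..N}" "x \<in> V" "Psi L \<nu> i x = x" "Psi L \<nu> j (2 * b - x) = 2 * b - x"
  shows "mirror i m \<longleftrightarrow> m = j"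
proof
  assume "mirror i m"
  then show "m = j"
    using mirror_iff_Psi[of i m x] corner_cell_unique[of j m "2 * b - x" "2 * b - x"] assms antipode by simp
next
  show "m = j \<Longrightarrow> mirror i m"
    using mirror_iff_Psi[of i m x] assms by simp
qed

section \<open>Two-colourings of cells of all levels\<close>

definition proper_colouring :: "(nat \<Rightarrow> bool) \<Rightarrow> bool" where
  "proper_colouring c \<longleftrightarrow> (\<forall>i\<in>{1..N}. \<forall>j\<in>{1..N}. \<forall>x\<in>V. \<forall>y\<in>V.
    i \<noteq> j \<and> Psi L \<nu> i x = Psi L \<nu> j y \<longrightarrow> c i \<noteq> c j)"

text \<open>Here \<open>s\<close> tells whether the point reflection preserves or swaps the colours,
  uniformly over all 1-cells.\<close>

definition mirror_parity :: "(nat \<Rightarrow> bool) \<Rightarrow> bool \<Rightarrow> bool" where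
  "mirror_parity c s \<longleftrightarrow> (\<forall>i\<in>{1..N}. \<exists>m. mirror i m \<and> ((c i = c m) = s))"

text \<open>Crossing a junction flips the colour of a cell and also that of its mirror cell, so
  whether the two agree is constant along paths. Connectivity carries the value from one corner cell
  to all cells.\<close>

lemma mirror_parity_exists:
  assumes c: "proper_colouring c"
  shows "\<exists>s. mirror_parity c s"
proof -
  obtain x where x: "x \<in> V"
    using card_V0 by fastforce
  obtain i0 m0 where i0: "i0 \<in> {1..N}" "Psi L \<nu> i0 x = x"
    and m0: "m0 \<in> {1..N}" "Psi L \<nu> m0 (2 * b - x) = 2 * b - x"
    using V_fixed x antipode by metis
  have "\<exists>m. mirror i m \<and> ((c i = c m) = (c i0 = c m0))" if "i \<in> {1..N}" for i
    using connectivity[rule_format, OF i0(1) that]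
  proof (induction rule: rtranclp_induct)
    case base
    then show ?case
      using mirror_corner i0 m0 x by blast
  next
    case (step i j)
    then obtain m where m: "mirror i m" "(c i = c m) = (c i0 = c m0)"
      by blast
    show ?case
    proof (cases "i = j")
      case False
      obtain x x' where x: "x \<in> V" "x' \<in> V" "Psi L \<nu> i x = Psi L \<nu> j x'"
        using step.hyps by blast
      obtain m' where m': "mirror j m'" "m' \<noteq> m" "Psi L \<nu> m (2 * b - x) = Psi L \<nu> m' (2 * b - x')"
        using mirror_step[OF m(1) _ _ False x] step.hyps by blast
      have "c i \<noteq> c j"
        using c x False step.hyps unfolding proper_colouring_def by blast
      moreover have "c m \<noteq> c m'"
        using c m' m(1) x antipode unfolding proper_colouring_def mirror_def by metis
      ultimately show ?thesis
        using m m' by blast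
    qed (use m in blast)
  qed
  then show ?thesis
    unfolding mirror_parity_def by blast
qed

end

text \<open>If opposite corner 1-cells have equal colours (s holds), then a junction of two (n+1)-cells
  joins equally coloured n-subcells, so the larger cells must be coloured differently; otherwise
  the subcells already have different colours and the larger cells must not be swapped.\<close>

fun word_colour :: "(nat \<Rightarrow> bool) \<Rightarrow> bool \<Rightarrow> nat list \<Rightarrow> bool" where
  "word_colour c s [] = True"
| "word_colour c s (i # w) =
    (if w = [] then c i else if s then c i = word_colour c s w else word_colour c s w)"

text \<open>The value True at the empty word and the normalisation \<open>c 1\<close> make padding
  harmless for either value of \<open>s\<close>.\<close>

lemma word_colour_pad: "c 1 \<Longrightarrow> word_colour c s (replicate n 1 @ w) = word_colour c s w"
  by (induction n) auto

lemma word_colour_replicate_cong: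
  "c i = c j \<Longrightarrow> word_colour c s (replicate n i) = word_colour c s (replicate n j)"
  by (induction n) auto

lemma word_colour_replicate_False: "word_colour c False (replicate (Suc n) i) = c i"
  by (induction n) auto

context central_nested_fractal
begin

text \<open>A common prefix acts equally on both colours. At the first differing letters, nesting
  places the junction at antipodal vertices of the two cells, so the remaining words are constant
  corner words.\<close>

lemma word_colour_adjacent:
  assumes c: "proper_colouring c" and s: "mirror_parity c s"
    and "length w = length w'" "set w \<subseteq> {1..N}" "set w' \<subseteq> {1..N}" "w \<noteq> w'"
    and v: "v \<in> V" "v' \<in> V" and "Psiw L \<nu> w v = Psiw L \<nu> w' v'"
  shows "word_colour c s w \<noteq> word_colour c s w'"
  using assms(3-6,9)
proof (induction w w' rule: list_induct2)
  case (Cons i u i' u')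
  have ii': "i \<in> {1..N}" "i' \<in> {1..N}" "set u \<subseteq> {1..N}" "set u' \<subseteq> {1..N}"
    using Cons.prems by auto
  show ?case
  proof (cases "i = i'")
    case True
    then have "u \<noteq> u'" "Psiw L \<nu> u v = Psiw L \<nu> u' v'"
      using Cons.prems by (auto simp: Psi_inject)
    moreover from this have "u \<noteq> []" "u' \<noteq> []"
      using Cons.hyps by auto
    ultimately show ?thesis
      using Cons.IH ii' True by auto
  next
    case False
    define x x' where "x = Psiw L \<nu> u v" and "x' = Psiw L \<nu> u' v'"
    have eq: "Psi L \<nu> i x = Psi L \<nu> i' x'"
      using Cons.prems by (simp add: x_def x'_def)
    have "x \<in> K0" "x' \<in> K0"
      unfolding x_def x'_def using Psiw_in_K ii' v V_subset_K by auto
    then have "Psi L \<nu> i x \<in> Psi L \<nu> i ` V \<inter> Psi L \<nu> i' ` V"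
      using nesting1[OF ii'(1,2) False] eq by blast
    then have x: "x \<in> V" "x' \<in> V"
      using eq by (auto simp: Psi_inject) (metis L_nz Psi_inject)
    have cii': "c i \<noteq> c i'"
      using c False ii' x eq unfolding proper_colouring_def by blast
    show ?thesis
    proof (cases u)
      case Nil
      then show ?thesis
        using cii' Cons.hyps by simp
    next
      case (Cons a u1)
      have x': "x' = 2 * b - x"
        using shared_vertex_antipodal1[OF ii'(1,2) False x eq] .
      obtain j j' where j: "j \<in> {1..N}" "Psi L \<nu> j x = x" "j' \<in> {1..N}" "Psi L \<nu> j' x' = x'"
        using V_fixed x by metis
      have u: "u = replicate (length u) j" "u' = replicate (length u) j'"
        using corner_word_unique[OF ii'(3) v(1) x(1) j(1,2)] corner_word_unique[OF ii'(4) v(2) x(2) j(3,4)]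
          Cons.hyps by (auto simp: x_def x'_def)
      have ne: "u \<noteq> []" "u' \<noteq> []"
        using Cons Cons.hyps by auto
      \<comment> \<open>The corner cells j and j' at x and 2b - x mirror each other, so
        \<open>s\<close> decides whether their colours agree.\<close>
      obtain m where m: "mirror j m" "(c j = c m) = s"
        using s j(1) unfolding mirror_parity_def by blast
      moreover have "m = j'"
        using mirror_corner[OF j(1,3) x(1) j(2)] j(4) m(1) x' by blast
      ultimately have jj': "(c j = c j') = s"
        by blast
      show ?thesis
      proof (cases s)
        case True
        then have "word_colour c s u = word_colour c s u'"
          using jj' word_colour_replicate_cong[of c j j'] u by metis
        then show ?thesis
          using ne cii' True by auto
      next
        case False
        have "length u = Suc (length u1)"
          using Cons by simp
        then have "word_colour c s u = c j" "word_colour c s u' = c j'"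
          using u word_colour_replicate_False False by metis+
        then show ?thesis
          using ne jj' False by auto
      qed
    qed
  qed
qed simp

section \<open>Complexes of the unbounded fractal\<close>

lemma pad_words:
  assumes "set w \<subseteq> {1..N}" "set w' \<subseteq> {1..N}"
  obtains m m' where "length (replicate m 1 @ w) = length (replicate m' 1 @ w')"
    "set (replicate m 1 @ w) \<subseteq> {1..N}" "set (replicate m' 1 @ w') \<subseteq> {1..N}"
proof (rule that[of "length w'" "length w"])
  have "set (replicate n 1) \<subseteq> {1..N}" for n
    using N_ge_2 by (induction n) auto
  then show "set (replicate (length w') 1 @ w) \<subseteq> {1..N}" "set (replicate (length w) 1 @ w') \<subseteq> {1..N}"
    using assms by (simp_all only: set_append Un_subset_iff)
qed simp

text \<open>After padding to equal length, scaling turns two 0-complexes into cells of K0. Different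
  shifts make the padded words different, so nesting and antipodality apply.\<close>

lemma intersecting_cells:
  assumes "set w \<subseteq> {1..N}" "set w' \<subseteq> {1..N}" "cell_shift L \<nu> w \<noteq> cell_shift L \<nu> w'"
    and y: "y \<in> K0" "y' \<in> K0" "y + cell_shift L \<nu> w = y' + cell_shift L \<nu> w'"
  shows "y \<in> V \<and> y' = 2 * b - y"
proof -
  obtain m m' where m: "length (replicate m 1 @ w) = length (replicate m' 1 @ w')"
    "set (replicate m 1 @ w) \<subseteq> {1..N}" "set (replicate m' 1 @ w') \<subseteq> {1..N}"
    using pad_words assms by blast
  define p p' where "p = replicate m 1 @ w" and "p' = replicate m' 1 @ w'"
  have sh: "cell_shift L \<nu> p = cell_shift L \<nu> w" "cell_shift L \<nu> p' = cell_shift L \<nu> w'"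
    unfolding p_def p'_def using cell_shift_pad nu_1 by blast+
  have p: "p \<in> words N (length p)" "p' \<in> words N (length p)" "p \<noteq> p'"
    using m sh assms(3) by (auto simp: words_def p_def p'_def)
  have eq: "Psiw L \<nu> p y = Psiw L \<nu> p' y'"
    using Psiw_eq_iff_cell_shift[OF L_nz, of p p'] sh y(3) p by (simp add: words_def)
  then have "Psiw L \<nu> p y \<in> Psiw L \<nu> p ` V \<inter> Psiw L \<nu> p' ` V"
    using nesting[OF p] y by blast
  then have "y \<in> V" "y' \<in> V"
    using eq by (auto simp: Psiw_inject) (metis L_nz Psiw_inject)
  then show ?thesis
    using shared_vertex_antipodal[OF p _ _ eq] by blast
qed

lemma is_shift_iff:
  "is_shift L N \<nu> M t \<longleftrightarrow> (\<exists>w. set w \<subseteq> {1..N} \<and> t = of_real (L powi M) * cell_shift L \<nu> w)"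
  using is_shift_cell_shift L_gt_1 N_ge_2 nu_1 by simp

lemma complexes_0: "complexes L N \<nu> K0 0 = {(\<lambda>z. z + cell_shift L \<nu> w) ` K0 | w. set w \<subseteq> {1..N}}"
  unfolding complexes_def is_shift_iff KM_def scaleM_def by auto

text \<open>Pairing each vertex with its antipode gives the mean b.\<close>

lemma barycenter_eq: "barycenter L N \<nu> M = of_real (L powi M) * b"
proof -
  have "(\<Sum>v\<in>V. v) = (\<Sum>v\<in>V. 2 * b - v)"
    by (rule sum.reindex_bij_witness[of _ "\<lambda>v. 2 * b - v" "\<lambda>v. 2 * b - v"]) (auto intro: antipode)
  then have "2 * (\<Sum>v\<in>V. v) = 2 * (of_nat (card V) * b)"
    by (simp add: sum_subtractf)
  then have sum: "(\<Sum>v\<in>V. v) = of_nat (card V) * b"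
    by simp
  have inj: "inj_on (scaleM L M) V"
    by (auto simp: inj_on_def scaleM_def)
  have "(\<Sum>v\<in>VMM L N \<nu> M. v) = of_real (L powi M) * (\<Sum>v\<in>V. v)"
    unfolding VMM_def sum.reindex[OF inj] by (simp add: scaleM_def sum_distrib_left)
  then show ?thesis
    using card_V0 unfolding barycenter_def sum VMM_def card_image[OF inj] by auto
qed

section \<open>From a good labelling to a split\<close>

lemma two_class_split_if_good_labelling:
  assumes good: "good_labelling L N \<nu> M lab"
  shows "two_class_split L N \<nu> K0"
proof -
  define T where "T = {cell_shift L \<nu> w | w. set w \<subseteq> {1..N}}"
  \<comment> \<open>The order M is arbitrary, but scaling by \<open>lam\<close> identifies
    0-complexes with M-complexes, so each shift in \<open>T\<close> receives a rotation
    factor.\<close>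
  define lam :: complex where "lam = of_real (L powi M)"
  have lam: "lam \<noteq> 0"
    by (simp add: lam_def)
  have VMM: "VMM L N \<nu> M = (*) lam ` V"
    by (simp add: VMM_def scaleM_def lam_def)
  have inj: "inj_on lab ((*) lam ` V)"
    using good unfolding good_labelling_def VMM bij_betw_def by blast
  have rotated: "\<forall>t. is_shift L N \<nu> M t \<longrightarrow>
      (\<exists>R\<in>rotations L N \<nu> M. \<forall>v\<in>(\<lambda>z. z + t) ` (*) lam ` V. lab v = lab (R (v - t)))"
    using good unfolding good_labelling_def VMM by (elim conjE)
  have "\<exists>c. c \<noteq> 0 \<and> (\<forall>v\<in>V. b + c * (v - b) \<in> V \<and> lab (lam * (v + t)) = lab (lam * (b + c * (v - b))))"
    if t: "t \<in> T" for t
  proof -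
    have "is_shift L N \<nu> M (lam * t)"
      using t unfolding is_shift_iff lam_def T_def by blast
    then obtain R where "R \<in> rotations L N \<nu> M"
      and lab: "\<And>v. v \<in> (\<lambda>z. z + lam * t) ` ((*) lam ` V) \<Longrightarrow> lab v = lab (R (v - lam * t))"
      using rotated[rule_format] by metis
    then obtain c where c: "cmod c = 1" "R = (\<lambda>z. lam * b + c * (z - lam * b))" "R ` ((*) lam ` V) = (*) lam ` V"
      unfolding rotations_def barycenter_eq VMM lam_def by blast
    have R: "R (lam * v) = lam * (b + c * (v - b))" for v
      unfolding c(2) by (simp add: algebra_simps)
    have "b + c * (v - b) \<in> V \<and> lab (lam * (v + t)) = lab (lam * (b + c * (v - b)))" if v: "v \<in> V" for v
    proof
      have "R (lam * v) \<in> (*) lam ` V"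
        using c(3) v by blast
      then show "b + c * (v - b) \<in> V"
        unfolding R using lam by auto
      have "lam * v + lam * t \<in> (\<lambda>z. z + lam * t) ` (*) lam ` V"
        using v by (intro imageI)
      from lab[OF this] have "lab (lam * v + lam * t) = lab (R (lam * v))"
        by simp
      then show "lab (lam * (v + t)) = lab (lam * (b + c * (v - b)))"
        unfolding R by (simp add: distrib_left)
    qed
    moreover have "c \<noteq> 0"
      using c(1) by auto
    ultimately show ?thesis
      by blast
  qed
  then obtain c where c: "\<And>t. t \<in> T \<Longrightarrow> c t \<noteq> 0"
    "\<And>t v. t \<in> T \<Longrightarrow> v \<in> V \<Longrightarrow> b + c t * (v - b) \<in> V"
    "\<And>t v. t \<in> T \<Longrightarrow> v \<in> V \<Longrightarrow> lab (lam * (v + t)) = lab (lam * (b + c t * (v - b)))"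
    by metis
  have opposite: "c t' = - c t"
    if t: "t \<in> T" "t' \<in> T" "t \<noteq> t'" "((\<lambda>z. z + t) ` K0) \<inter> ((\<lambda>z. z + t') ` K0) \<noteq> {}" for t t'
  proof -
    obtain v v' where v: "v \<in> K0" "v' \<in> K0" "v + t = v' + t'"
      using t(4) by auto
    then have v': "v \<in> V" "v' = 2 * b - v"
      using intersecting_cells t(1-3) unfolding T_def by blast+
    then have "v' \<in> V"
      using antipode by simp
    \<comment> \<open>A common vertex has one label, read off through either complex; injectivity on
      the base complex turns this into an equation between the rotations.\<close>
    then have "lab (lam * (b + c t * (v - b))) = lab (lam * (b + c t' * (v' - b)))"
      using c(3) t v(3) v'(1) by metis
    then have "lam * (b + c t * (v - b)) = lam * (b + c t' * (v' - b))"
      using inj c(2) t v' \<open>v' \<in> V\<close> by (meson image_eqI inj_onD)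
    then have "b + c t * (v - b) = b + c t' * (v' - b)"
      using lam by simp
    then have "c t * (v - b) = - c t' * (v - b)"
      by (simp add: v'(2) algebra_simps)
    moreover have "v - b \<noteq> 0"
      using circle[OF v'(1)] r_pos by auto
    ultimately have "c t = - c t'"
      using mult_right_cancel by blast
    then show ?thesis
      by simp
  qed
  \<comment> \<open>A half-plane with half of its boundary line contains exactly one of z and -z for
    z \<noteq> 0.\<close>
  define upper :: "complex \<Rightarrow> bool" where "upper z \<longleftrightarrow> Im z > 0 \<or> Im z = 0 \<and> Re z > 0" for z
  have upper: "upper (- z) \<longleftrightarrow> \<not> upper z" if "z \<noteq> 0" for z
    using that by (auto simp: upper_def complex_eq_iff)
  define C where "C = {\<Delta>\<in>complexes L N \<nu> K0 0. \<Delta> \<subseteq> KM L K0 1}"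
  define C1 where "C1 = {\<Delta>\<in>C. \<exists>t\<in>T. \<Delta> = (\<lambda>z. z + t) ` K0 \<and> upper (c t)}"
  have shift: "\<exists>t\<in>T. \<Delta> = (\<lambda>z. z + t) ` K0" if "\<Delta> \<in> C" for \<Delta>
    using that unfolding C_def complexes_0 T_def by blast
  have alternate: "\<Delta>' \<in> C1 \<longleftrightarrow> \<Delta> \<notin> C1"
    if \<Delta>: "\<Delta> \<in> C" "\<Delta>' \<in> C" "\<Delta>' \<noteq> \<Delta>" "\<Delta> \<inter> \<Delta>' \<noteq> {}" for \<Delta> \<Delta>'
  proof -
    \<comment> \<open>This holds for every choice of shifts representing the two sets, so the
      existential quantifier in \<open>C1\<close> causes no ambiguity.\<close>
    have differ: "upper (c t') \<longleftrightarrow> \<not> upper (c t)"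
      if "t \<in> T" "t' \<in> T" "\<Delta> = (\<lambda>z. z + t) ` K0" "\<Delta>' = (\<lambda>z. z + t') ` K0" for t t'
    proof -
      have "c t' = - c t"
        using that \<Delta> by (intro opposite) auto
      then show ?thesis
        using upper c(1) that(1) by simp
    qed
    then show ?thesis
      using \<Delta>(1,2) shift[OF \<Delta>(1)] shift[OF \<Delta>(2)] unfolding C1_def by blast
  qed
  show ?thesis
    unfolding two_class_split_def Let_def C_def[symmetric]
  proof (rule exI[of _ C1], rule exI[of _ "C - C1"], intro conjI ballI impI)
    show "C1 \<union> (C - C1) = C"
      by (auto simp: C1_def)
  next
    fix \<Delta> \<Delta>' assume "\<Delta> \<in> C1" "\<Delta>' \<in> C" "\<Delta>' \<noteq> \<Delta> \<and> \<Delta> \<inter> \<Delta>' \<noteq> {}"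
    then show "\<Delta>' \<in> C - C1"
      using alternate[of \<Delta> \<Delta>'] unfolding C1_def by blast
  next
    fix \<Delta> \<Delta>' assume "\<Delta> \<in> C - C1" "\<Delta>' \<in> C" "\<Delta>' \<noteq> \<Delta> \<and> \<Delta> \<inter> \<Delta>' \<noteq> {}"
    then show "\<Delta>' \<in> C1"
      using alternate[of \<Delta> \<Delta>'] by blast
  qed auto
qed

section \<open>From a split to a good labelling\<close>

lemma proper_colouring_if_two_class_split:
  assumes "two_class_split L N \<nu> K0"
  shows "\<exists>c. proper_colouring c"
proof -
  define C where "C = {\<Delta>\<in>complexes L N \<nu> K0 0. \<Delta> \<subseteq> KM L K0 1}"
  obtain C1 C2 where C12: "C1 \<inter> C2 = {}" "C1 \<union> C2 = C"
    "\<forall>\<Delta>\<in>C1. \<forall>\<Delta>'\<in>C. \<Delta>' \<noteq> \<Delta> \<and> \<Delta> \<inter> \<Delta>' \<noteq> {} \<longrightarrow> \<Delta>' \<in> C2"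
    "\<forall>\<Delta>\<in>C2. \<forall>\<Delta>'\<in>C. \<Delta>' \<noteq> \<Delta> \<and> \<Delta> \<inter> \<Delta>' \<noteq> {} \<longrightarrow> \<Delta>' \<in> C1"
    using assms unfolding two_class_split_def Let_def C_def[symmetric] by (elim exE conjE)
  define cell where "cell i = (\<lambda>z. z + of_real L * \<nu> i) ` K0" for i
  have cell_Psi: "cell i = (*) (of_real L) ` Psi L \<nu> i ` K0" for i
    unfolding cell_def image_image by (simp add: Psi_def ring_distribs)
  have cell: "cell i \<in> C" if "i \<in> {1..N}" for i
  proof -
    have "cell i \<in> complexes L N \<nu> K0 0"
      using that unfolding complexes_0 cell_def by (auto intro!: exI[of _ "[i]"])
    moreover have "cell i \<subseteq> KM L K0 1"
      using Psi_in_K[OF that] unfolding cell_Psi KM_def scaleM_def by auto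
    ultimately show ?thesis
      by (simp add: C_def)
  qed
  \<comment> \<open>The split concerns cells as sets and the colouring concerns indices. If two
    cells coincided, every vertex would be a junction, and u - (2b - u) would be the same for all
    vertices u.\<close>
  have cell_neq: "cell i \<noteq> cell j" if ij: "i \<in> {1..N}" "j \<in> {1..N}" "i \<noteq> j" for i j
  proof
    assume "cell i = cell j"
    then have eq: "Psi L \<nu> i ` K0 = Psi L \<nu> j ` K0"
      unfolding cell_Psi by (simp add: inj_image_eq_iff inj_on_def)
    have *: "Psi L \<nu> i u = Psi L \<nu> j (2 * b - u)" if "u \<in> V" for u
    proof -
      have "Psi L \<nu> i u \<in> Psi L \<nu> i ` K0 \<inter> Psi L \<nu> j ` K0"
        using that eq V_subset_K by blast
      then obtain u' where "u' \<in> V" "Psi L \<nu> i u = Psi L \<nu> j u'"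
        using nesting1[OF ij] by blast
      then show ?thesis
        using shared_vertex_antipodal1[OF ij that] by metis
    qed
    obtain v v' where "v \<in> V" "v' \<in> V" "v \<noteq> v'" "v' \<noteq> 2 * b - v"
      using nonantipodal_pair .
    with *[of v] *[of v'] have "\<nu> i + v * 2 / of_real L = \<nu> i + v' * 2 / of_real L"
      unfolding Psi_def diff_divide_distrib by (simp add: algebra_simps)
    then have "v = v'"
      by simp
    then show False
      using \<open>v \<noteq> v'\<close> by simp
  qed
  have "proper_colouring (\<lambda>i. cell i \<in> C1)"
    unfolding proper_colouring_def
  proof (intro ballI impI)
    fix i j x y
    assume ij: "i \<in> {1..N}" "j \<in> {1..N}" and xy: "x \<in> V" "y \<in> V" "i \<noteq> j \<and> Psi L \<nu> i x = Psi L \<nu> j y"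
    have "Psi L \<nu> i x \<in> Psi L \<nu> i ` K0" "Psi L \<nu> i x \<in> Psi L \<nu> j ` K0"
      using xy V_subset_K by blast+
    then have "cell i \<inter> cell j \<noteq> {}"
      unfolding cell_Psi by blast
    then show "(cell i \<in> C1) \<noteq> (cell j \<in> C1)"
      using C12 cell[OF ij(1)] cell[OF ij(2)] cell_neq[OF ij] xy(3)
      by (metis Un_iff disjoint_iff)
  qed
  then show ?thesis
    by blast
qed

text \<open>Each 0-complex copies a fixed labelling of V, directly or after the half turn, according
  to the colour of its word. At a shared vertex exactly one of two different complexes is turned,
  and the half turn exchanges v and 2b - v, so the labels agree.\<close>

lemma good_labelling_if_proper_colouring:
  assumes "proper_colouring c"
  shows "\<exists>lab. good_labelling L N \<nu> 0 lab"
proof -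
  \<comment> \<open>Recolouring so that cell 1 has colour True makes word colours invariant under
    padding.\<close>
  define d where "d i = (c i = c 1)" for i
  have d: "proper_colouring d" "d 1"
    using assms by (auto simp: proper_colouring_def d_def)
  obtain s where s: "mirror_parity d s"
    using mirror_parity_exists[OF d(1)] by blast
  define turn where "turn w v = (if word_colour d s w then v else 2 * b - v)" for w v
  have turn_unique: "turn w v = turn w' v'"
    if w: "set w \<subseteq> {1..N}" "set w' \<subseteq> {1..N}" and v: "v \<in> V" "v' \<in> V"
      and eq: "v + cell_shift L \<nu> w = v' + cell_shift L \<nu> w'" for w w' v v'
  proof -
    obtain m m' where m: "length (replicate m 1 @ w) = length (replicate m' 1 @ w')"
      "set (replicate m 1 @ w) \<subseteq> {1..N}" "set (replicate m' 1 @ w') \<subseteq> {1..N}"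
      using pad_words w by blast
    define p p' where "p = replicate m 1 @ w" and "p' = replicate m' 1 @ w'"
    have sh: "cell_shift L \<nu> p = cell_shift L \<nu> w" "cell_shift L \<nu> p' = cell_shift L \<nu> w'"
      unfolding p_def p'_def using cell_shift_pad nu_1 by blast+
    have col: "word_colour d s p = word_colour d s w" "word_colour d s p' = word_colour d s w'"
      unfolding p_def p'_def using word_colour_pad d(2) by blast+
    show ?thesis
    proof (cases "p = p'")
      case True
      then show ?thesis
        using sh col eq by (simp add: turn_def)
    next
      case False
      have "Psiw L \<nu> p v = Psiw L \<nu> p' v'"
        using Psiw_eq_iff_cell_shift[OF L_nz m(1)] eq sh by (simp add: p_def p'_def)
      moreover have "p \<in> words N (length p)" "p' \<in> words N (length p)"
        using m by (auto simp: words_def p_def p'_def)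
      ultimately have "v' = 2 * b - v" "word_colour d s p \<noteq> word_colour d s p'"
        using shared_vertex_antipodal[OF _ _ False v] word_colour_adjacent[OF d(1) s _ _ _ False v]
          m by (auto simp: p_def p'_def)
      then show ?thesis
        using col by (auto simp: turn_def)
    qed
  qed
  obtain lab0 where lab0: "bij_betw lab0 V {..<card V}"
    using ex_bij_betw_finite_nat[OF finite_V] by (auto simp: atLeast0LessThan)
  \<comment> \<open>The choice ranges over all representations of x as a vertex of some complex; by
    \<open>turn_unique\<close> they give the same value.\<close>
  define lab where "lab x = lab0 (SOME u. \<exists>w v. set w \<subseteq> {1..N} \<and> v \<in> V \<and>
    x = v + cell_shift L \<nu> w \<and> u = turn w v)" for x
  have lab: "lab (v + cell_shift L \<nu> w) = lab0 (turn w v)" if "set w \<subseteq> {1..N}" "v \<in> V" for w v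
    unfolding lab_def
  proof (rule arg_cong[of _ _ lab0], rule some_equality)
    show "\<exists>w' v'. set w' \<subseteq> {1..N} \<and> v' \<in> V \<and>
        v + cell_shift L \<nu> w = v' + cell_shift L \<nu> w' \<and> turn w v = turn w' v'"
      by (intro exI[of _ w] exI[of _ v] conjI refl that)
  next
    fix u assume "\<exists>w' v'. set w' \<subseteq> {1..N} \<and> v' \<in> V \<and>
        v + cell_shift L \<nu> w = v' + cell_shift L \<nu> w' \<and> u = turn w' v'"
    then obtain w' v' where "set w' \<subseteq> {1..N}" "v' \<in> V"
        "v + cell_shift L \<nu> w = v' + cell_shift L \<nu> w'" "u = turn w' v'"
      by (elim exE conjE)
    then show "u = turn w v"
      using turn_unique[of w w' v v'] that by simp
  qed
  have lab_V: "lab v = lab0 v" if "v \<in> V" for v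
    using lab[of "[]" v] that by (simp add: turn_def)
  have VMM: "VMM L N \<nu> 0 = V"
    by (simp add: VMM_def scaleM_def)
  have shift: "is_shift L N \<nu> 0 t \<longleftrightarrow> (\<exists>w. set w \<subseteq> {1..N} \<and> t = cell_shift L \<nu> w)" for t
    unfolding is_shift_iff by simp
  have turn_V: "turn w v \<in> V" if "v \<in> V" for w v
    using that antipode by (simp add: turn_def)
  have turn_rotation: "turn w \<in> rotations L N \<nu> 0" for w
  proof -
    have "turn w = (\<lambda>z. b + (if word_colour d s w then 1 else - 1) * (z - b))"
      by (auto simp: turn_def fun_eq_iff)
    moreover have "turn w ` V = V"
    proof
      have "turn w (turn w v) = v" for v
        by (simp add: turn_def)
      then show "V \<subseteq> turn w ` V"
        using turn_V by (metis image_eqI subsetI)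
    qed (use turn_V in blast)
    moreover have "cmod (if word_colour d s w then 1 else - 1) = 1"
      by simp
    ultimately show ?thesis
      unfolding rotations_def VMM barycenter_eq by fastforce
  qed
  have "good_labelling L N \<nu> 0 lab"
    unfolding good_labelling_def VMM
  proof (intro conjI ballI allI impI)
    fix x assume "x \<in> VMinf L N \<nu> 0"
    then obtain w v where "set w \<subseteq> {1..N}" "v \<in> V" "x = v + cell_shift L \<nu> w"
      unfolding VMinf_def VMM shift by auto
    then show "lab x \<in> {..<card V}"
      using lab turn_V lab0 by (metis bij_betwE)
  next
    show "bij_betw lab V {..<card V}"
      using lab0 bij_betw_cong[of V lab lab0] lab_V by blast
  next
    fix t assume "is_shift L N \<nu> 0 t"
    then obtain w where "set w \<subseteq> {1..N}" "t = cell_shift L \<nu> w"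
      unfolding shift by blast
    then have "lab x = lab (turn w (x - t))" if "x \<in> (\<lambda>z. z + t) ` V" for x
      using that lab lab_V turn_V by auto
    then show "\<exists>R\<in>rotations L N \<nu> 0. \<forall>x\<in>(\<lambda>z. z + t) ` V. lab x = lab (R (x - t))"
      using turn_rotation by blast
  qed
  then show ?thesis
    by blast
qed

end

section \<open>Even regular polygons and the equivalence\<close>

text \<open>With k = 2h vertices, the half turn moves the index by h. Adding h below h and
  subtracting it otherwise keeps the index below k.\<close>

lemma regular_polygon_central:
  assumes "regular_polygon V" "even (card V)"
  obtains b r where "\<And>v. v \<in> V \<Longrightarrow> cmod (v - b) = r" "\<And>v. v \<in> V \<Longrightarrow> 2 * b - v \<in> V"
proof -
  define k where "k = card V"
  obtain b r \<theta> where r: "r > 0"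
    and V: "V = {b + of_real r * cis (\<theta> + 2 * pi * real j / real k) | j. j < k}"
    using assms unfolding regular_polygon_def k_def by blast
  define p where "p j = b + of_real r * cis (\<theta> + 2 * pi * real j / real k)" for j
  have V: "V = p ` {..<k}"
    unfolding V p_def by auto
  obtain h where h: "k = 2 * h"
    using assms(2) unfolding k_def by blast
  have half_turn: "p (j + h) = 2 * b - p j" if "h > 0" for j
  proof -
    have "\<theta> + 2 * pi * real (j + h) / real k = (\<theta> + 2 * pi * real j / real k) + pi"
      using that by (simp add: h field_simps)
    then show ?thesis
      unfolding p_def by (simp add: cis_mult[symmetric])
  qed
  show thesis
  proof (rule that[of b r])
    fix v assume "v \<in> V"
    then obtain j where j: "j < k" "v = p j"
      unfolding V by blast
    show "cmod (v - b) = r"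
      using r unfolding j p_def by (simp add: norm_mult)
    have "h > 0"
      using j(1) h by simp
    have "\<exists>i<k. p i = 2 * b - v"
    proof (cases "j < h")
      case True
      then show ?thesis
        using half_turn[OF \<open>h > 0\<close>, of j] j h by (intro exI[of _ "j + h"]) auto
    next
      case False
      then show ?thesis
        using half_turn[OF \<open>h > 0\<close>, of "j - h"] j h by (intro exI[of _ "j - h"]) auto
    qed
    then show "2 * b - v \<in> V"
      unfolding V by force
  qed
qed

theorem theorem3p14:
  fixes L :: real and N :: nat and \<nu> :: "nat \<Rightarrow> complex" and K0 :: "complex set"
  assumes "planar_simple_nested_fractal L N \<nu> K0"
    and "regular_polygon (V0 L N \<nu>)"
    and "card (V0 L N \<nu>) \<ge> 3"
    and "even (card (V0 L N \<nu>))"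
  shows "good_labelling_property L N \<nu> \<longleftrightarrow> two_class_split L N \<nu> K0"
proof -
  obtain b r where "\<And>v. v \<in> V0 L N \<nu> \<Longrightarrow> cmod (v - b) = r"
    "\<And>v. v \<in> V0 L N \<nu> \<Longrightarrow> 2 * b - v \<in> V0 L N \<nu>"
    using regular_polygon_central assms(2,4) by blast
  then interpret central_nested_fractal L N \<nu> K0 b r
    using assms by unfold_locales
  show ?thesis
    unfolding good_labelling_property_def
    using two_class_split_if_good_labelling proper_colouring_if_two_class_split
      good_labelling_if_proper_colouring by blast
qed

end
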